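(* Let $0<\delta<1$ and $w>\sqrt{e}$. Given a finite (nonempty) set of parameter values $\mathcal{S}\subset\mathcal{P}$, the condition $$K\geq\max\left\{\frac{\log(\#\mathcal{S})+\log(\delta^{-1})}{\log(w/\sqrt{e})},\ 3\right\}$$ on the integer $K$ is sufficient to ensure $$\mathbb{P}\Big\{w^{-1}\Delta(\mu)\leq\|u(\mu)-\widetilde u(\mu)\|_\Sigma\leq w\,\Delta(\mu),\ \ \forall\mu\in\mathcal{S}\Big\}\geq 1-\delta.$$
   Context: Let $\mathcal{P}\subset\mathbb{R}^P$ be a parameter set. For every $\mu\in\mathcal{P}$, $A(\mu)\in\mathbb{R}^{N\times N}$ is an invertible matrix, $f(\mu)\in\mathbb{R}^N$, $u(\mu)\in\mathbb{R}^N$ is the solution of $A(\mu)u(\mu)=f(\mu)$, and $\widetilde u(\mu)\in\mathbb{R}^N$ is a given (deterministic) approximation of $u(\mu)$. Let $\Sigma\in\mathbb{R}^{N\times N}$ be symmetric positive semi-definite and $\|v\|_\Sigma=(v^T\Sigma v)^{1/2}$ for $v\in\mathbb{R}^N$. Let $Z_1,\ldots,Z_K$ be independent copies of a zero-mean Gaussian vector $Z\sim\mathcal{N}(0,\Sigma)$ in $\mathbb{R}^N$ with (possibly singular) covariance $\Sigma$. The error estimator is $$\Delta(\mu)=\left(\frac1K\sum_{i=1}^K\big(Z_i^T(u(\mu)-\widetilde u(\mu))\big)^2\right)^{1/2}.$$ $\#\mathcal{S}$ denotes the cardinality of $\mathcal{S}$. *)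

theory Defs
  imports "HOL-Probability.Probability"
begin

definition psd_matrix :: "real^'n^'n \<Rightarrow> bool" where
  "psd_matrix \<Sigma> \<longleftrightarrow> transpose \<Sigma> = \<Sigma> \<and> (\<forall>v. 0 \<le> v \<bullet> (\<Sigma> *v v))"

definition cov_norm :: "real^'n^'n \<Rightarrow> real^'n \<Rightarrow> real" where
  "cov_norm \<Sigma> v = sqrt (v \<bullet> (\<Sigma> *v v))"

text \<open>The univariate normal law, including the degenerate case of zero standard deviation
  (a point mass), for which the library's \<open>normal_density\<close> is not a probability density.\<close>

definition normal_law :: "real \<Rightarrow> real \<Rightarrow> real measure" where
  "normal_law m s =
     (if s = 0 then return borel m else density lborel (\<lambda>x. ennreal (normal_density m s x)))"

text \<open>A Gaussian vector is one all of whose linear combinations of components are univariate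
  normal, possibly degenerate; this permits a singular covariance matrix.\<close>

definition gaussian_vector :: "'a measure \<Rightarrow> ('a \<Rightarrow> real^'n) \<Rightarrow> bool" where
  "gaussian_vector M X \<longleftrightarrow>
     X \<in> borel_measurable M \<and>
     (\<forall>v. \<exists>m s. 0 \<le> s \<and> distr M borel (\<lambda>\<omega>. v \<bullet> X \<omega>) = normal_law m s)"

text \<open>All the integrals below exist when \<open>X\<close> is a Gaussian vector.\<close>

definition mean_vector :: "'a measure \<Rightarrow> ('a \<Rightarrow> real^'n) \<Rightarrow> real^'n" where
  "mean_vector M X = (\<chi> i. \<integral>\<omega>. X \<omega> $ i \<partial>M)"

definition covariance_matrix :: "'a measure \<Rightarrow> ('a \<Rightarrow> real^'n) \<Rightarrow> real^'n^'n" where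
  "covariance_matrix M X =
     (\<chi> i j. \<integral>\<omega>. (X \<omega> $ i - mean_vector M X $ i) * (X \<omega> $ j - mean_vector M X $ j) \<partial>M)"

definition error_estimator :: "nat \<Rightarrow> (nat \<Rightarrow> 'a \<Rightarrow> real^'n) \<Rightarrow> real^'n \<Rightarrow> real^'n \<Rightarrow> 'a \<Rightarrow> real" where
  "error_estimator K Z u u' \<omega> = sqrt (1 / real K * (\<Sum>i=1..K. (Z i \<omega> \<bullet> (u - u'))\<^sup>2))"

end

theory Submission
  imports Defs
begin

text \<open>Fix one parameter, put \<open>v = u - u_approx\<close> and \<open>s = cov_norm \<Sigma> v\<close>. The numbers \<open>v \<bullet> Z i\<close> are
  independent centred normal variables with standard deviation \<open>s\<close>
  (\<open>gaussian_vector_projection\<close>), so the squared estimator is \<open>s\<^sup>2 / K\<close> times a chi-squared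
  variable with \<open>K\<close> degrees of freedom. If \<open>s > 0\<close>, the two-sided bound fails
  exactly if this variable exceeds \<open>K w\<^sup>2\<close> or lies below \<open>K / w\<^sup>2\<close>. The Chernoff bound, optimised over its free parameter, says
  that the tail beyond \<open>K c\<close> has probability at most \<open>(c e\<^bsup>1 - c\<^esup>)\<^bsup>K/2\<^esup>\<close>; the same expression serves
  the upper tail (\<open>c > 1\<close>) and the lower tail (\<open>c < 1\<close>), see \<open>chernoff_sum_squares_normal\<close>.

  With \<open>x = w\<^sup>2\<close>, the choices \<open>c = x\<close> and \<open>c = 1 / x\<close> give the tail bounds \<open>(\<surd>e / w)\<^sup>K\<close> times
  \<open>(x e\<^bsup>-x/2\<^esup>)\<^sup>K\<close> and times \<open>(e\<^bsup>-1/(2x)\<^esup>)\<^sup>K\<close>. These two factors add up to at most 1 as soon as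
  \<open>x \<ge> e\<close> and \<open>K \<ge> 3\<close> (\<open>chernoff_rates_sum_le_one\<close>), so a single parameter fails with probability
  at most \<open>(\<surd>e / w)\<^sup>K\<close> (\<open>prob_empirical_rms_outside\<close>). A union bound over \<open>S\<close> gives
  \<open>#S (\<surd>e / w)\<^sup>K\<close>, and the hypothesis on \<open>K\<close> says, after taking logarithms, that this is at
  most \<open>\<delta>\<close>.\<close>

section \<open>Adding the two tail rates\<close>

text \<open>The rational value is just large enough for the numerical step of
  \<open>chernoff_rates_sum_le_one\<close>, where the simpler bound \<open>e \<ge> 5/2\<close> from the quadratic Taylor
  polynomial evaluated at 1 is too weak; the same polynomial evaluated at \<open>1/8\<close>, raised to the
  eighth power, is accurate enough.\<close>

lemma exp_one_ge: "27 / 10 \<le> exp (1::real)"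
proof -
  have "27 / 10 \<le> (1 + 1 / 8 + (1 / 8)\<^sup>2 / 2 :: real) ^ 8"
    by (simp add: power2_eq_square eval_nat_numeral)
  also have "\<dots> \<le> exp (1 / 8) ^ 8"
    by (intro power_mono exp_lower_Taylor_quadratic) auto
  also have "\<dots> = exp (1::real)"
    by (simp flip: exp_of_nat_mult)
  finally show ?thesis .
qed

text \<open>Both bases are at most 1, so \<open>n = 3\<close> is the worst case. There the two terms are bounded by
  fractions that add up to exactly 1: the lower rate by \<open>2x / (2x + 3)\<close>, using
  \<open>e\<^bsup>y\<^esup> \<ge> 1 + y\<close>, and the upper rate by \<open>3 / (2x + 3)\<close>, that is,
  \<open>x\<^sup>3 (1 + 2x/3) \<le> e\<^bsup>3x/2\<^esup>\<close>. The latter splits the exponent \<open>3x/2\<close> into \<open>3x/e\<close>, which pays for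
  the cube, and a remainder that pays for the linear factor; each payment is an instance of
  \<open>e t \<le> e\<^bsup>t\<^esup>\<close>.\<close>

lemma chernoff_rates_sum_le_one:
  fixes x :: real
  assumes x: "exp 1 \<le> x" and n: "3 \<le> n"
  shows "exp (- 1 / (2 * x)) ^ n + (x * exp (- x / 2)) ^ n \<le> 1"
proof -
  have e: "27 / 10 \<le> exp (1::real)" by (rule exp_one_ge)
  with x have x0: "0 < x" and x27: "27 / 10 \<le> x" by auto
  have tangent: "exp 1 * t \<le> exp t" for t :: real
  proof -
    have "t \<le> exp (t - 1)" using exp_ge_add_one_self[of "t - 1"] by simp
    then have "exp 1 * t \<le> exp 1 * exp (t - 1)" by simp
    then show ?thesis by (simp flip: exp_add)
  qed
  have cube: "x ^ 3 \<le> exp (3 * x / exp 1)"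
  proof -
    have "x ^ 3 \<le> exp (x / exp 1) ^ 3"
      using tangent[of "x / exp 1"] x0 by (intro power_mono) auto
    then show ?thesis by (simp flip: exp_of_nat_mult)
  qed
  \<comment> \<open>The middle expression is what \<open>e t \<le> e\<^bsup>t\<^esup>\<close> yields at \<open>t = (3/2 - 3/e) x\<close>, minus \<open>2x/3\<close>;
    \<open>11/3\<close> is \<open>3 + 2/3\<close>.\<close>
  have "1 \<le> (3 / 2 * (27 / 10) - 11 / 3) * (27 / 10 :: real)" by simp
  also have "\<dots> \<le> (3 / 2 * exp 1 - 11 / 3) * x"
    using e x27 by (intro mult_mono) auto
  also have "\<dots> = exp 1 * ((3 / 2 - 3 / exp 1) * x) - 2 * x / 3"
    by (simp add: field_simps)
  finally have "1 + 2 * x / 3 \<le> exp 1 * ((3 / 2 - 3 / exp 1) * x)" by simp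
  also have "\<dots> \<le> exp ((3 / 2 - 3 / exp 1) * x)" by (rule tangent)
  finally have lin: "1 + 2 * x / 3 \<le> exp ((3 / 2 - 3 / exp 1) * x)" .
  have "x ^ 3 * (1 + 2 * x / 3) \<le> exp (3 * x / exp 1) * exp ((3 / 2 - 3 / exp 1) * x)"
    using cube lin x0 by (intro mult_mono) auto
  also have "\<dots> = exp (3 * x / 2)"
    by (simp add: algebra_simps flip: exp_add)
  finally have "x ^ 3 * exp (- (3 * x / 2)) \<le> 3 / (2 * x + 3)"
    using x0 by (simp add: exp_minus field_simps)
  moreover have "(x * exp (- x / 2)) ^ 3 = x ^ 3 * exp (- (3 * x / 2))"
    by (simp add: power_mult_distrib flip: exp_of_nat_mult)
  ultimately have upper: "(x * exp (- x / 2)) ^ 3 \<le> 3 / (2 * x + 3)" by simp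
  have "exp (- 1 / (2 * x)) ^ 3 = exp (- (3 / (2 * x)))"
    by (simp flip: exp_of_nat_mult)
  also have "\<dots> = inverse (exp (3 / (2 * x)))" by (rule exp_minus)
  also have "\<dots> \<le> inverse (1 + 3 / (2 * x))"
    using x0 by (intro le_imp_inverse_le exp_ge_add_one_self) (simp add: add_pos_pos)
  also have "\<dots> = 2 * x / (2 * x + 3)" using x0 by (simp add: field_simps)
  finally have lower: "exp (- 1 / (2 * x)) ^ 3 \<le> 2 * x / (2 * x + 3)" .
  have "3 / (2 * x + 3) \<le> 1" using x0 by simp
  with upper have "(x * exp (- x / 2)) ^ 3 \<le> 1" by linarith
  then have "x * exp (- x / 2) \<le> 1"
    using x0 by (subst (asm) power_le_one_iff) auto
  then have "(x * exp (- x / 2)) ^ n \<le> (x * exp (- x / 2)) ^ 3"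
    using x0 n by (intro power_decreasing) auto
  moreover have "exp (- 1 / (2 * x)) ^ n \<le> exp (- 1 / (2 * x)) ^ 3"
    using x0 n by (intro power_decreasing) auto
  moreover have "2 * x / (2 * x + 3) + 3 / (2 * x + 3) = 1"
    using x0 by (simp flip: add_divide_distrib)
  ultimately show ?thesis using upper lower by linarith
qed

section \<open>One-dimensional projections of a Gaussian vector\<close>

lemma sets_normal_law [simp, measurable_cong]: "sets (normal_law m s) = sets borel"
  by (simp add: normal_law_def)

lemma normal_law_moments:
  assumes "0 \<le> s"
  shows "integrable (normal_law m s) (\<lambda>x. x)"
    and "integrable (normal_law m s) (\<lambda>x. x\<^sup>2)"
    and "(\<integral>x. x \<partial>normal_law m s) = m"
    and "(\<integral>x. x\<^sup>2 \<partial>normal_law m s) = m\<^sup>2 + s\<^sup>2"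
proof -
  have "integrable (normal_law m s) (\<lambda>x. x) \<and> integrable (normal_law m s) (\<lambda>x. x\<^sup>2) \<and>
    (\<integral>x. x \<partial>normal_law m s) = m \<and> (\<integral>x. x\<^sup>2 \<partial>normal_law m s) = m\<^sup>2 + s\<^sup>2"
  proof (cases "s = 0")
    case True
    interpret prob_space "return borel m" by (rule prob_space_return) simp
    have int: "integrable (return borel m) g" if "g \<in> borel_measurable borel" for g :: "real \<Rightarrow> real"
      using that by (simp add: integrable_iff_bounded nn_integral_return)
    show ?thesis using True by (auto simp: normal_law_def integral_return intro!: int)
  next
    case False
    with assms have s: "0 < s" by simp
    let ?p = "normal_density m s"
    have m0: "has_bochner_integral lborel ?p 1"
      using s integrable_normal_density integral_normal_density by (simp add: has_bochner_integral_iff)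
    have m1: "has_bochner_integral lborel (\<lambda>x. ?p x * x) m"
      using s by (rule normal_moment_nz_1)
    have m2: "has_bochner_integral lborel (\<lambda>x. ?p x * (x - m)\<^sup>2) (s\<^sup>2)"
      using normal_moment_even[OF s, of m 1] by (simp add: eval_nat_numeral)
    \<comment> \<open>Expand \<open>x\<^sup>2 = (x - m)\<^sup>2 + 2 m x - m\<^sup>2\<close>.\<close>
    have "has_bochner_integral lborel
        (\<lambda>x. ?p x * (x - m)\<^sup>2 + 2 * m * (?p x * x) - m\<^sup>2 * ?p x) (s\<^sup>2 + 2 * m * m - m\<^sup>2 * 1)"
      by (intro has_bochner_integral_diff has_bochner_integral_add m0 m1 m2
          has_bochner_integral_mult_right)
    moreover have "?p x * (x - m)\<^sup>2 + 2 * m * (?p x * x) - m\<^sup>2 * ?p x = ?p x * x\<^sup>2" for x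
      by (simp add: power2_eq_square algebra_simps)
    ultimately have "has_bochner_integral lborel (\<lambda>x. ?p x * x\<^sup>2) (m\<^sup>2 + s\<^sup>2)"
      by (simp add: power2_eq_square algebra_simps)
    with m1 s show ?thesis
      by (simp add: normal_law_def integrable_density integral_density has_bochner_integral_iff)
  qed
  then show "integrable (normal_law m s) (\<lambda>x. x)"
    and "integrable (normal_law m s) (\<lambda>x. x\<^sup>2)"
    and "(\<integral>x. x \<partial>normal_law m s) = m"
    and "(\<integral>x. x\<^sup>2 \<partial>normal_law m s) = m\<^sup>2 + s\<^sup>2"
    by auto
qed

lemma (in prob_space) moments_of_normal_law:
  assumes [measurable]: "X \<in> borel_measurable M"
    and X: "distr M borel X = normal_law m s" and s: "0 \<le> s"
  shows "integrable M X" and "integrable M (\<lambda>\<omega>. (X \<omega>)\<^sup>2)"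
    and "expectation X = m" and "expectation (\<lambda>\<omega>. (X \<omega>)\<^sup>2) = m\<^sup>2 + s\<^sup>2"
  using normal_law_moments[OF s, of m, folded X]
  by (simp_all add: integrable_distr_eq integral_distr)

text \<open>The law of \<open>v \<bullet> Z\<close> is normal by definition, hence determined by its first two moments, and
  these are a linear and a quadratic form in \<open>v\<close> whose coefficients are the entries of the mean
  vector and of the covariance matrix. To expand them one needs the products of components to be
  integrable; this holds because each component is itself a projection of \<open>Z\<close>, along a
  coordinate axis, and so has a finite second moment.\<close>

lemma (in prob_space) gaussian_vector_projection:
  fixes Z :: "'a \<Rightarrow> real^'n"
  assumes Z: "gaussian_vector M Z" and mean: "mean_vector M Z = 0"
    and cov: "covariance_matrix M Z = \<Sigma>"
  shows "distr M borel (\<lambda>\<omega>. v \<bullet> Z \<omega>) = normal_law 0 (cov_norm \<Sigma> v)"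
proof -
  have [measurable]: "Z \<in> borel_measurable M"
    using Z by (simp add: gaussian_vector_def)
  have Zi: "Z \<omega> $ i = axis i 1 \<bullet> Z \<omega>" for \<omega> i by (simp add: inner_axis')
  have [measurable]: "(\<lambda>\<omega>. Z \<omega> $ i) \<in> borel_measurable M" for i
    unfolding Zi by measurable
  have "\<exists>m s. 0 \<le> s \<and> distr M borel (\<lambda>\<omega>. Z \<omega> $ i) = normal_law m s" for i
    using Z unfolding Zi gaussian_vector_def by blast
  then have int1 [simp]: "integrable M (\<lambda>\<omega>. Z \<omega> $ i)"
    and int2: "integrable M (\<lambda>\<omega>. (Z \<omega> $ i)\<^sup>2)" for i
    using moments_of_normal_law(1,2)[of "\<lambda>\<omega>. Z \<omega> $ i"] by fastforce+
  have prod [simp]: "integrable M (\<lambda>\<omega>. Z \<omega> $ i * Z \<omega> $ j)" for i j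
  proof (rule Bochner_Integration.integrable_bound)
    show "integrable M (\<lambda>\<omega>. (Z \<omega> $ i)\<^sup>2 + (Z \<omega> $ j)\<^sup>2)" by (intro Bochner_Integration.integrable_add int2)
    have "\<bar>a * b\<bar> \<le> a\<^sup>2 + b\<^sup>2" for a b :: real
      using sum_squares_bound[of "\<bar>a\<bar>" "\<bar>b\<bar>"] mult_nonneg_nonneg[OF abs_ge_zero[of a] abs_ge_zero[of b]]
      unfolding abs_mult power2_abs mult.assoc by linarith
    then show "AE \<omega> in M. norm (Z \<omega> $ i * Z \<omega> $ j) \<le> norm ((Z \<omega> $ i)\<^sup>2 + (Z \<omega> $ j)\<^sup>2)"
      by simp
  qed measurable
  have mean0: "expectation (\<lambda>\<omega>. Z \<omega> $ i) = 0" for i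
    using mean by (simp add: mean_vector_def vec_eq_iff)
  have cov0: "expectation (\<lambda>\<omega>. Z \<omega> $ i * Z \<omega> $ j) = \<Sigma> $ i $ j" for i j
    using cov mean by (auto simp: covariance_matrix_def)
  obtain m s where s: "0 \<le> s" and law: "distr M borel (\<lambda>\<omega>. v \<bullet> Z \<omega>) = normal_law m s"
    using Z unfolding gaussian_vector_def by blast
  have "m = expectation (\<lambda>\<omega>. v \<bullet> Z \<omega>)"
    by (rule moments_of_normal_law(3)[OF _ law s, symmetric]) measurable
  also have "\<dots> = 0" by (simp add: inner_vec_def mean0)
  finally have m: "m = 0" .
  have "m\<^sup>2 + s\<^sup>2 = expectation (\<lambda>\<omega>. (v \<bullet> Z \<omega>)\<^sup>2)"
    by (rule moments_of_normal_law(4)[OF _ law s, symmetric]) measurable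
  also have "\<dots> = expectation (\<lambda>\<omega>. \<Sum>i\<in>UNIV. \<Sum>j\<in>UNIV. v $ i * v $ j * (Z \<omega> $ i * Z \<omega> $ j))"
    by (simp add: inner_vec_def power2_eq_square sum_product mult_ac)
  also have "\<dots> = (\<Sum>i\<in>UNIV. \<Sum>j\<in>UNIV. v $ i * v $ j * \<Sigma> $ i $ j)"
    by (simp add: cov0)
  also have "\<dots> = v \<bullet> (\<Sigma> *v v)"
    by (simp add: inner_vec_def matrix_vector_mult_def sum_distrib_left mult_ac)
  finally have "v \<bullet> (\<Sigma> *v v) = s\<^sup>2" using m by simp
  with s have "cov_norm \<Sigma> v = s" by (simp add: cov_norm_def)
  with law m show ?thesis by simp
qed

section \<open>Chernoff bounds for sums of squared normal variables\<close>

text \<open>Multiplying the centred normal density by \<open>e\<^bsup>a x\<^sup>2 / (2 s\<^sup>2)\<^esup>\<close> gives, up to the factor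
  \<open>(1 - a)\<^bsup>-1/2\<^esup>\<close>, the normal density with the larger or smaller variance \<open>s\<^sup>2 / (1 - a)\<close>, which
  integrates to 1.\<close>

lemma (in prob_space) nn_integral_exp_square_normal:
  assumes [measurable]: "X \<in> borel_measurable M"
    and X: "distr M borel X = normal_law 0 s" and s: "0 < s" and a: "a < 1"
  shows "(\<integral>\<^sup>+\<omega>. ennreal (exp (a * (X \<omega>)\<^sup>2 / (2 * s\<^sup>2))) \<partial>M) = ennreal (1 / sqrt (1 - a))"
proof -
  define t where "t = s / sqrt (1 - a)"
  have t: "0 < t" using s a by (simp add: t_def)
  have t2: "t\<^sup>2 = s\<^sup>2 / (1 - a)" using a by (simp add: t_def power_divide)
  have tilt: "normal_density 0 s x * exp (a * x\<^sup>2 / (2 * s\<^sup>2)) = 1 / sqrt (1 - a) * normal_density 0 t x" for x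
  proof -
    have "- x\<^sup>2 / (2 * s\<^sup>2) + a * x\<^sup>2 / (2 * s\<^sup>2) = - x\<^sup>2 / (2 * t\<^sup>2)"
      using s a by (simp add: t2 field_simps)
    then have "exp (- x\<^sup>2 / (2 * s\<^sup>2)) * exp (a * x\<^sup>2 / (2 * s\<^sup>2)) = exp (- x\<^sup>2 / (2 * t\<^sup>2))"
      by (simp flip: exp_add)
    moreover have "sqrt (2 * pi * t\<^sup>2) = sqrt (2 * pi * s\<^sup>2) / sqrt (1 - a)"
      by (simp add: t2 real_sqrt_divide)
    ultimately show ?thesis using a s by (simp add: normal_density_def)
  qed
  have "(\<integral>\<^sup>+\<omega>. ennreal (exp (a * (X \<omega>)\<^sup>2 / (2 * s\<^sup>2))) \<partial>M)
      = (\<integral>\<^sup>+x. ennreal (exp (a * x\<^sup>2 / (2 * s\<^sup>2))) \<partial>normal_law 0 s)"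
    unfolding X[symmetric] by (simp add: nn_integral_distr)
  also have "\<dots> = (\<integral>\<^sup>+x. ennreal (1 / sqrt (1 - a)) * ennreal (normal_density 0 t x) \<partial>lborel)"
    using s a by (simp add: normal_law_def nn_integral_density tilt flip: ennreal_mult)
  also have "\<dots> = ennreal (1 / sqrt (1 - a)) * (\<integral>\<^sup>+x. ennreal (normal_density 0 t x) \<partial>lborel)"
    by (rule nn_integral_cmult) measurable
  also have "(\<integral>\<^sup>+x. ennreal (normal_density 0 t x) \<partial>lborel) = 1"
    using t by (subst nn_integral_eq_integral) auto
  finally show ?thesis by simp
qed

text \<open>The number \<open>a\<close> is the Chernoff parameter that minimises
  \<open>e\<^bsup>-a c n / 2\<^esup> (1 - a)\<^bsup>-n/2\<^esup>\<close>, the bound that Markov's inequality gives for the exponential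
  of \<open>a / (2 s\<^sup>2)\<close> times the sum of squares. It is positive for \<open>c > 1\<close> and negative for \<open>c < 1\<close>.
  Keeping it as a factor on both sides of the event therefore expresses the upper tail and the lower
  tail by one statement.\<close>

lemma (in prob_space) chernoff_sum_squares_normal:
  fixes Y :: "'i \<Rightarrow> 'a \<Rightarrow> real"
  assumes I: "finite I" and indep: "indep_vars (\<lambda>_. borel) Y I"
    and Y: "\<And>i. i \<in> I \<Longrightarrow> distr M borel (Y i) = normal_law 0 s"
    and s: "0 < s" and c: "0 < c"
  defines "a \<equiv> 1 - 1 / c"
  shows "prob {\<omega>\<in>space M. a * (c * s\<^sup>2 * card I) \<le> a * (\<Sum>i\<in>I. (Y i \<omega>)\<^sup>2)}
      \<le> sqrt (c * exp (1 - c)) ^ card I"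
proof -
  have [measurable]: "Y i \<in> borel_measurable M" if "i \<in> I" for i
    using indep that by (auto simp: indep_vars_def)
  let ?b = "a / (2 * s\<^sup>2)"
  let ?e = "\<lambda>i \<omega>. ennreal (exp (a * (Y i \<omega>)\<^sup>2 / (2 * s\<^sup>2)))"
  let ?k = "exp ((1 - c) / 2) ^ card I"
  have a: "a < 1" using c by (simp add: a_def)
  have indep': "indep_vars (\<lambda>_. borel) ?e I"
    by (rule indep_vars_compose2[OF indep]) measurable
  have prod: "(\<Prod>i\<in>I. ?e i \<omega>) = ennreal (exp (?b * (\<Sum>i\<in>I. (Y i \<omega>)\<^sup>2)))" for \<omega>
    by (simp add: prod_ennreal sum_distrib_left exp_sum I)
  have "(\<integral>\<^sup>+\<omega>. (\<Prod>i\<in>I. ?e i \<omega>) \<partial>M) = (\<Prod>i\<in>I. \<integral>\<^sup>+\<omega>. ?e i \<omega> \<partial>M)"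
    by (rule indep_vars_nn_integral[OF I indep']) simp
  also have "\<dots> = (\<Prod>i\<in>I. ennreal (sqrt c))"
  proof (rule prod.cong[OF refl])
    fix i assume i: "i \<in> I"
    have "1 / sqrt (1 - a) = sqrt c" using c by (simp add: a_def real_sqrt_divide)
    with nn_integral_exp_square_normal[OF _ Y[OF i] s a] i
    show "(\<integral>\<^sup>+\<omega>. ?e i \<omega> \<partial>M) = ennreal (sqrt c)" by simp
  qed
  also have "\<dots> = ennreal (sqrt c ^ card I)" using c by (simp add: ennreal_power)
  finally have mgf: "(\<integral>\<^sup>+\<omega>. (\<Prod>i\<in>I. ?e i \<omega>) \<partial>M) = ennreal (sqrt c ^ card I)" .
  have k: "?k = exp (- (?b * (c * s\<^sup>2 * card I)))"
    using s c by (simp add: a_def field_simps flip: exp_of_nat_mult)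
  have "emeasure M {\<omega>\<in>space M. a * (c * s\<^sup>2 * card I) \<le> a * (\<Sum>i\<in>I. (Y i \<omega>)\<^sup>2)}
      \<le> emeasure M {\<omega>\<in>space M. 1 \<le> ennreal ?k * (\<Prod>i\<in>I. ?e i \<omega>)}"
  proof (rule emeasure_mono)
    show "{\<omega>\<in>space M. a * (c * s\<^sup>2 * card I) \<le> a * (\<Sum>i\<in>I. (Y i \<omega>)\<^sup>2)}
      \<subseteq> {\<omega>\<in>space M. 1 \<le> ennreal ?k * (\<Prod>i\<in>I. ?e i \<omega>)}"
    proof safe
      fix \<omega> assume "a * (c * s\<^sup>2 * card I) \<le> a * (\<Sum>i\<in>I. (Y i \<omega>)\<^sup>2)"
      then have "?b * (c * s\<^sup>2 * card I) \<le> ?b * (\<Sum>i\<in>I. (Y i \<omega>)\<^sup>2)"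
        using divide_right_mono[of _ _ "2 * s\<^sup>2"] by fastforce
      then have "1 \<le> ?k * exp (?b * (\<Sum>i\<in>I. (Y i \<omega>)\<^sup>2))"
        unfolding k by (simp flip: exp_add)
      then show "1 \<le> ennreal ?k * (\<Prod>i\<in>I. ?e i \<omega>)"
        unfolding prod by (simp flip: ennreal_mult)
    qed
  qed measurable
  also have "\<dots> \<le> ennreal ?k * (\<integral>\<^sup>+\<omega>. (\<Prod>i\<in>I. ?e i \<omega>) * indicator (space M) \<omega> \<partial>M)"
    using nn_integral_Markov_inequality[of "\<lambda>\<omega>. \<Prod>i\<in>I. ?e i \<omega>" "space M" M "ennreal ?k"] by simp
  also have "(\<integral>\<^sup>+\<omega>. (\<Prod>i\<in>I. ?e i \<omega>) * indicator (space M) \<omega> \<partial>M) = ennreal (sqrt c ^ card I)"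
    unfolding mgf[symmetric] by (intro nn_integral_cong) simp
  also have "ennreal ?k * ennreal (sqrt c ^ card I) = ennreal (?k * sqrt c ^ card I)"
    using c by (simp add: ennreal_mult)
  also have "?k * sqrt c ^ card I = sqrt (c * exp (1 - c)) ^ card I"
  proof -
    have "exp ((1 - c) / 2) = sqrt (exp (1 - c))"
      by (rule real_sqrt_unique[symmetric]) (auto simp flip: exp_of_nat_mult)
    then show ?thesis by (simp add: real_sqrt_mult power_mult_distrib)
  qed
  finally show ?thesis using c
    by (simp add: emeasure_eq_measure)
qed

section \<open>Estimating a standard deviation by the root mean square\<close>

text \<open>For \<open>s > 0\<close> the event is covered by the two tails of \<open>chernoff_sum_squares_normal\<close> with
  \<open>c = w\<^sup>2\<close> and \<open>c = 1 / w\<^sup>2\<close>. For \<open>s = 0\<close>, which a singular covariance matrix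
  allows, all the variables vanish almost surely and both inequalities read \<open>0 \<le> 0\<close>.\<close>

lemma (in prob_space) prob_empirical_rms_outside:
  fixes Y :: "'i \<Rightarrow> 'a \<Rightarrow> real"
  assumes I: "finite I" "3 \<le> card I" and indep: "indep_vars (\<lambda>_. borel) Y I"
    and Y: "\<And>i. i \<in> I \<Longrightarrow> distr M borel (Y i) = normal_law 0 s"
    and s: "0 \<le> s" and w: "sqrt (exp 1) < w"
  defines "\<Delta> \<equiv> \<lambda>\<omega>. sqrt (1 / card I * (\<Sum>i\<in>I. (Y i \<omega>)\<^sup>2))"
  shows "prob {\<omega>\<in>space M. \<not> (inverse w * \<Delta> \<omega> \<le> s \<and> s \<le> w * \<Delta> \<omega>)} \<le> (sqrt (exp 1) / w) ^ card I"
proof (cases "s = 0")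
  case True
  have m [measurable]: "Y i \<in> borel_measurable M" if "i \<in> I" for i
    using indep that by (auto simp: indep_vars_def)
  have "AE \<omega> in M. Y i \<omega> = 0" if i: "i \<in> I" for i
  proof -
    have "distr M borel (Y i) = return borel 0"
      using True Y[OF i] by (simp add: normal_law_def)
    moreover have "AE x in return borel (0::real). x = 0"
      by (subst AE_return) auto
    ultimately have "AE x in distr M borel (Y i). x = 0" by metis
    then show ?thesis using m[OF i] by (simp add: AE_distr_iff)
  qed
  then have "AE \<omega> in M. \<forall>i\<in>I. Y i \<omega> = 0"
    using I by (simp add: AE_finite_all)
  then have "AE \<omega> in M. \<not> \<not> (inverse w * \<Delta> \<omega> \<le> s \<and> s \<le> w * \<Delta> \<omega>)"
    by eventually_elim (simp add: \<Delta>_def True)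
  then have "prob {\<omega>\<in>space M. \<not> (inverse w * \<Delta> \<omega> \<le> s \<and> s \<le> w * \<Delta> \<omega>)} = 0"
    by (intro prob_eq_0_AE)
  moreover have "0 < w" using w by (smt (verit) exp_gt_zero real_sqrt_gt_zero)
  ultimately show ?thesis by simp
next
  case False
  with s have s: "0 < s" by simp
  have [measurable]: "Y i \<in> borel_measurable M" if "i \<in> I" for i
    using indep that by (auto simp: indep_vars_def)
  let ?n = "card I" and ?T = "\<lambda>\<omega>. \<Sum>i\<in>I. (Y i \<omega>)\<^sup>2"
  let ?E = "\<lambda>c. {\<omega>\<in>space M. (1 - 1 / c) * (c * s\<^sup>2 * ?n) \<le> (1 - 1 / c) * ?T \<omega>}"
  have w0: "0 < w" using w by (smt (verit) exp_gt_zero real_sqrt_gt_zero)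
  have n: "0 < ?n" using I by simp
  have w2: "exp 1 < w\<^sup>2"
    using power_strict_mono[OF w, of 2] by simp
  have w1: "1 < w\<^sup>2" using w2 exp_one_ge by linarith
  have T0: "0 \<le> ?T \<omega>" for \<omega> by (simp add: sum_nonneg)
  have D2: "(\<Delta> \<omega>)\<^sup>2 = ?T \<omega> / ?n" and D0: "0 \<le> \<Delta> \<omega>" for \<omega>
    using T0[of \<omega>] by (simp_all add: \<Delta>_def)
  have "{\<omega>\<in>space M. \<not> (inverse w * \<Delta> \<omega> \<le> s \<and> s \<le> w * \<Delta> \<omega>)} \<subseteq> ?E (1 / w\<^sup>2) \<union> ?E (w\<^sup>2)"
  proof (rule subsetI, rule ccontr)
    fix \<omega>
    assume bad: "\<omega> \<in> {\<omega>\<in>space M. \<not> (inverse w * \<Delta> \<omega> \<le> s \<and> s \<le> w * \<Delta> \<omega>)}"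
      and notin: "\<omega> \<notin> ?E (1 / w\<^sup>2) \<union> ?E (w\<^sup>2)"
    have upper: "?T \<omega> < w\<^sup>2 * s\<^sup>2 * ?n"
    proof -
      have "0 < 1 - 1 / w\<^sup>2"
        using w1 by (simp only: diff_gt_0_iff_gt divide_less_eq_1_pos[OF less_trans[OF zero_less_one w1]])
      moreover have "\<not> (1 - 1 / w\<^sup>2) * (w\<^sup>2 * s\<^sup>2 * ?n) \<le> (1 - 1 / w\<^sup>2) * ?T \<omega>"
        using bad notin by blast
      ultimately show ?thesis by (simp only: mult_le_cancel_left_pos not_le)
    qed
    have lower: "1 / w\<^sup>2 * s\<^sup>2 * ?n < ?T \<omega>"
    proof -
      have "1 - 1 / (1 / w\<^sup>2) < 0" using w1 by simp
      moreover have "\<not> (1 - 1 / (1 / w\<^sup>2)) * (1 / w\<^sup>2 * s\<^sup>2 * ?n) \<le> (1 - 1 / (1 / w\<^sup>2)) * ?T \<omega>"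
        using bad notin by blast
      ultimately show ?thesis by (simp only: mult_le_cancel_left_neg not_le)
    qed
    have "(\<Delta> \<omega>)\<^sup>2 \<le> (w * s)\<^sup>2"
      using upper n by (simp add: D2 divide_le_eq power_mult_distrib)
    then have *: "\<Delta> \<omega> \<le> w * s"
      by (rule power2_le_imp_le) (use w0 s in simp)
    have "s\<^sup>2 * ?n \<le> w\<^sup>2 * ?T \<omega>"
      using mult_left_mono[OF less_imp_le[OF lower], of "w\<^sup>2"] w0 by simp
    then have "s\<^sup>2 \<le> w\<^sup>2 * ?T \<omega> / ?n"
      using n by (subst pos_le_divide_eq) linarith+
    then have "s\<^sup>2 \<le> (w * \<Delta> \<omega>)\<^sup>2"
      by (simp only: power_mult_distrib D2 times_divide_eq_right)
    moreover have "0 \<le> w * \<Delta> \<omega>" using w0 D0[of \<omega>] by (intro mult_nonneg_nonneg) linarith+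
    ultimately have "s \<le> w * \<Delta> \<omega>" by (rule power2_le_imp_le)
    moreover have "inverse w * \<Delta> \<omega> \<le> s"
      using * w0 by (simp add: inverse_eq_divide pos_divide_le_eq mult.commute)
    ultimately show False using bad by blast
  qed
  then have "prob {\<omega>\<in>space M. \<not> (inverse w * \<Delta> \<omega> \<le> s \<and> s \<le> w * \<Delta> \<omega>)} \<le> prob (?E (1 / w\<^sup>2) \<union> ?E (w\<^sup>2))"
    by (intro finite_measure_mono) measurable
  also have "\<dots> \<le> prob (?E (1 / w\<^sup>2)) + prob (?E (w\<^sup>2))"
    by (intro measure_Un_le) measurable
  also have "\<dots> \<le> sqrt (1 / w\<^sup>2 * exp (1 - 1 / w\<^sup>2)) ^ ?n + sqrt (w\<^sup>2 * exp (1 - w\<^sup>2)) ^ ?n"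
    using w0 by (intro add_mono chernoff_sum_squares_normal[OF I(1) indep Y s]) auto
  also have "\<dots> = (sqrt (exp 1) / w) ^ ?n * (exp (- 1 / (2 * w\<^sup>2)) ^ ?n + (w\<^sup>2 * exp (- w\<^sup>2 / 2)) ^ ?n)"
  proof -
    have half: "sqrt (exp y) = exp (y / 2)" for y :: real
      by (rule real_sqrt_unique) (auto simp flip: exp_of_nat_mult)
    have "sqrt (1 / w\<^sup>2 * exp (1 - 1 / w\<^sup>2)) = sqrt (exp 1) / w * exp (- 1 / (2 * w\<^sup>2))"
      using w0 by (simp add: real_sqrt_mult real_sqrt_divide half diff_divide_distrib flip: exp_add)
    moreover have "sqrt (w\<^sup>2 * exp (1 - w\<^sup>2)) = sqrt (exp 1) / w * (w\<^sup>2 * exp (- w\<^sup>2 / 2))"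
      using w0 by (simp add: real_sqrt_mult half diff_divide_distrib power2_eq_square flip: exp_add)
    ultimately show ?thesis by (simp only: power_mult_distrib distrib_left)
  qed
  also have "\<dots> \<le> (sqrt (exp 1) / w) ^ ?n * 1"
    using w0 w2 I by (intro mult_left_mono chernoff_rates_sum_le_one) auto
  finally show ?thesis by simp
qed
section \<open>Simultaneous certification by a union bound\<close>

theorem corollary2p5:
  fixes \<P> :: "(real^'p) set"
    and A :: "real^'p \<Rightarrow> real^'n^'n"
    and f u u_approx :: "real^'p \<Rightarrow> real^'n"
    and \<Sigma> :: "real^'n^'n"
    and M :: "'a measure"
    and Z :: "nat \<Rightarrow> 'a \<Rightarrow> real^'n"
    and K :: nat
    and \<delta> w :: real
    and S :: "(real^'p) set"
  assumes "\<And>\<mu>. \<mu> \<in> \<P> \<Longrightarrow> invertible (A \<mu>)"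
    and "\<And>\<mu>. \<mu> \<in> \<P> \<Longrightarrow> A \<mu> *v u \<mu> = f \<mu>"
    and "psd_matrix \<Sigma>"
    and "prob_space M"
    and "prob_space.indep_vars M (\<lambda>_. borel) Z {1..K}"
    and "\<And>i. i \<in> {1..K} \<Longrightarrow> gaussian_vector M (Z i)"
    and "\<And>i. i \<in> {1..K} \<Longrightarrow> mean_vector M (Z i) = 0"
    and "\<And>i. i \<in> {1..K} \<Longrightarrow> covariance_matrix M (Z i) = \<Sigma>"
    and "0 < \<delta>" and "\<delta> < 1"
    and "w > sqrt (exp 1)"
    and "finite S" and "S \<noteq> {}" and "S \<subseteq> \<P>"
    and "real K \<ge> max ((ln (real (card S)) + ln (inverse \<delta>)) / ln (w / sqrt (exp 1))) 3"
  shows "measure M {\<omega> \<in> space M. \<forall>\<mu>\<in>S.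
           inverse w * error_estimator K Z (u \<mu>) (u_approx \<mu>) \<omega> \<le> cov_norm \<Sigma> (u \<mu> - u_approx \<mu>) \<and>
           cov_norm \<Sigma> (u \<mu> - u_approx \<mu>) \<le> w * error_estimator K Z (u \<mu>) (u_approx \<mu>) \<omega>}
         \<ge> 1 - \<delta>"
proof -
  interpret prob_space M by fact
  let ?r = "sqrt (exp 1) / w"
  let ?good = "\<lambda>\<mu> \<omega>. inverse w * error_estimator K Z (u \<mu>) (u_approx \<mu>) \<omega> \<le> cov_norm \<Sigma> (u \<mu> - u_approx \<mu>) \<and>
           cov_norm \<Sigma> (u \<mu> - u_approx \<mu>) \<le> w * error_estimator K Z (u \<mu>) (u_approx \<mu>) \<omega>"
  have indep: "indep_vars (\<lambda>_. borel) Z {1..K}" and w: "sqrt (exp 1) < w" and "finite S" by fact+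
  have K: "3 \<le> K"
    and Kln: "(ln (real (card S)) + ln (inverse \<delta>)) / ln (w / sqrt (exp 1)) \<le> real K"
    using assms(15) by auto
  have [measurable]: "Z i \<in> borel_measurable M" if "i \<in> {1..K}" for i
    using assms(6)[OF that] by (simp add: gaussian_vector_def)
  have [measurable]: "error_estimator K Z x y \<in> borel_measurable M" for x y
    unfolding error_estimator_def by measurable
  have w0: "0 < w" using w by (smt (verit) exp_gt_zero real_sqrt_gt_zero)
  have card: "0 < card S" using assms(12,13) by (simp add: card_gt_0_iff)
  have each: "prob {\<omega>\<in>space M. \<not> ?good \<mu> \<omega>} \<le> ?r ^ K" for \<mu>
  proof -
    let ?v = "u \<mu> - u_approx \<mu>"
    have "prob {\<omega>\<in>space M. \<not>
        (inverse w * sqrt (1 / card {1..K} * (\<Sum>i\<in>{1..K}. (?v \<bullet> Z i \<omega>)\<^sup>2)) \<le> cov_norm \<Sigma> ?v \<and>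
         cov_norm \<Sigma> ?v \<le> w * sqrt (1 / card {1..K} * (\<Sum>i\<in>{1..K}. (?v \<bullet> Z i \<omega>)\<^sup>2)))}
      \<le> ?r ^ card {1..K}"
    proof (rule prob_empirical_rms_outside)
      show "indep_vars (\<lambda>_. borel) (\<lambda>i \<omega>. ?v \<bullet> Z i \<omega>) {1..K}"
        by (rule indep_vars_compose2[OF indep]) measurable
      show "distr M borel (\<lambda>\<omega>. ?v \<bullet> Z i \<omega>) = normal_law 0 (cov_norm \<Sigma> ?v)" if "i \<in> {1..K}" for i
        by (rule gaussian_vector_projection) (use assms(6-8) that in auto)
      show "0 \<le> cov_norm \<Sigma> ?v"
        using \<open>psd_matrix \<Sigma>\<close> by (simp add: cov_norm_def psd_matrix_def)
    qed (use K w in auto)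
    then show ?thesis by (simp add: error_estimator_def inner_commute)
  qed
  have "prob {\<omega>\<in>space M. \<exists>\<mu>\<in>S. \<not> ?good \<mu> \<omega>} = prob (\<Union>\<mu>\<in>S. {\<omega>\<in>space M. \<not> ?good \<mu> \<omega>})"
    by (rule arg_cong[where f = prob]) auto
  also have "\<dots> \<le> (\<Sum>\<mu>\<in>S. prob {\<omega>\<in>space M. \<not> ?good \<mu> \<omega>})"
    using \<open>finite S\<close> by (intro finite_measure_subadditive_finite) auto
  also have "\<dots> \<le> card S * ?r ^ K"
    using sum_mono[of S, OF each] by simp
  also have "\<dots> \<le> \<delta>"
  proof -
    have "0 < ln (w / sqrt (exp 1))" using w by (intro ln_gt_zero) simp
    with Kln have "ln (real (card S)) + ln (inverse \<delta>) \<le> real K * ln (w / sqrt (exp 1))"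
      by (simp add: field_simps)
    also have "\<dots> = ln ((w / sqrt (exp 1)) ^ K)"
      by (rule ln_realpow[symmetric])
    finally have "ln (real (card S) * inverse \<delta>) \<le> ln ((w / sqrt (exp 1)) ^ K)"
      using card \<open>0 < \<delta>\<close> by (simp add: ln_mult)
    then have "real (card S) * inverse \<delta> \<le> (w / sqrt (exp 1)) ^ K"
      using card w0 \<open>0 < \<delta>\<close> by (subst (asm) ln_le_cancel_iff) auto
    then show ?thesis
      using w0 \<open>0 < \<delta>\<close> by (simp add: power_divide field_simps)
  qed
  finally have bad: "prob {\<omega>\<in>space M. \<exists>\<mu>\<in>S. \<not> ?good \<mu> \<omega>} \<le> \<delta>" .
  have "{\<omega>\<in>space M. \<forall>\<mu>\<in>S. ?good \<mu> \<omega>} = space M - {\<omega>\<in>space M. \<exists>\<mu>\<in>S. \<not> ?good \<mu> \<omega>}" by blast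
  moreover have "{\<omega>\<in>space M. \<exists>\<mu>\<in>S. \<not> ?good \<mu> \<omega>} \<in> events"
    using \<open>finite S\<close> by measurable
  ultimately show ?thesis using bad by (simp only: prob_compl)
qed

end
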